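(* Consider the online approval committee election problem with $n$ voters, $m$ candidates and committee size $k\le m$, with the Multiwinner Approval Voting score $\mathrm{sc}(W)=\sum_{c\in W}|N(c)|$, and assume (UI): each voter approves each candidate with the same known probability $p\in[0,1]$, all these approval events being independent. Then an optimal safe policy (a safe policy maximizing the expected score of the selected committee among all safe policies) can be computed in time $O(n^2km)$.
   Context: Setting. There are voters $N=\{1,\dots,n\}$ and $m$ candidates $c_1,\dots,c_m$ appearing one at a time in this order; exactly $k\le m$ of them have to be selected. When $c_t$ appears, the set $N(c_t)\subseteq N$ of voters approving $c_t$ is revealed, and it must be decided immediately and irrevocably whether $c_t$ is selected ("yes") or not ("no"), without knowledge of the approvals of later candidates. Assumption (UI). The events "voter $i$ approves candidate $c_t$" ($i\in N$, $1\le t\le m$) are mutually independent and each has probability $p$, which is known in advance. Policies. A history is a sequence $\langle (c_t,N(c_t),a_t) : t=1,\dots,q\rangle$, $q\le m$, with $a_t\in\{\text{yes},\text{no}\}$; it is terminal if $q=m$ or the number of selected candidates is $k$. A policy $\pi$ decides, at each step $t$ and after $N(c_t)$ is observed, whether $c_t$ is selected. A policy is safe if every terminal history it induces selects exactly $k$ candidates. For a terminal history $h$ of a safe policy, $W(h)$ is the set of selected candidates. The expected score of a safe policy $\pi$ is $\mathbb{E}_{h\sim\pi}[\mathrm{sc}(W(h))]$, where the distribution over histories is induced by the random approvals and $\pi$. An optimal safe policy is a safe policy with maximal expected score. Representation of the output. A policy is represented as a table mapping each state $(\alpha,\beta,\gamma)$ to an action in $\{\text{yes},\text{no}\}$, where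 $\alpha\in\{1,\dots,m\}$ is the number of candidates seen so far including the current one, $\beta\in\{0,\dots,\min(k,\alpha-1)\}$ is the number of candidates selected so far, and $\gamma\in\{0,\dots,n\}$ is the number of voters approving the current candidate. The input is $(n,m,k,p)$, and running time counts elementary arithmetic operations and comparisons on real numbers at unit cost. *)

theory Defs
  imports "HOL-Probability.Probability" "HOL-Probability.Product_PMF"
begin

section \<open>The online election model\<close>

text \<open>
  Voters are the numbers \<open>1, \<dots>, n\<close>, and the candidate appearing at time \<open>t\<close> is the
  number \<open>t\<close>. An approval profile maps each candidate to the set of voters approving it.
\<close>

datatype action = Yes | No

type_synonym profile = "nat \<Rightarrow> nat set"
type_synonym history = "(nat \<times> nat set \<times> action) list"

text \<open>
  A policy sees the full history before the current candidate and the set of voters approving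
  the current candidate; it is not restricted to the information kept in a table.
\<close>
type_synonym policy = "history \<Rightarrow> nat set \<Rightarrow> action"

definition profile_on :: "nat \<Rightarrow> nat \<Rightarrow> profile \<Rightarrow> bool" where
  "profile_on n m N \<longleftrightarrow> (\<forall>t\<in>{1..m}. N t \<subseteq> {1..n})"

definition selected :: "history \<Rightarrow> nat set" where
  "selected h = {c. \<exists>A. (c, A, Yes) \<in> set h}"

definition terminal :: "nat \<Rightarrow> nat \<Rightarrow> history \<Rightarrow> bool" where
  "terminal m k h \<longleftrightarrow> length h = m \<or> card (selected h) = k"

fun play :: "nat \<Rightarrow> nat \<Rightarrow> policy \<Rightarrow> profile \<Rightarrow> nat \<Rightarrow> history" where
  "play m k \<pi> N 0 = []"
| "play m k \<pi> N (Suc t) =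
     (let h = play m k \<pi> N t in
      if terminal m k h then h else h @ [(Suc t, N (Suc t), \<pi> h (N (Suc t)))])"

text \<open>
  After \<open>m\<close> rounds \<^const>\<open>play\<close> has certainly reached a terminal history, at which it stays.
\<close>
definition terminal_history :: "nat \<Rightarrow> nat \<Rightarrow> policy \<Rightarrow> profile \<Rightarrow> history" where
  "terminal_history m k \<pi> N = play m k \<pi> N m"

definition safe :: "nat \<Rightarrow> nat \<Rightarrow> nat \<Rightarrow> policy \<Rightarrow> bool" where
  "safe n m k \<pi> \<longleftrightarrow>
     (\<forall>N. profile_on n m N \<longrightarrow> card (selected (terminal_history m k \<pi> N)) = k)"

definition mav_score :: "profile \<Rightarrow> nat set \<Rightarrow> nat" where
  "mav_score N W = (\<Sum>c\<in>W. card (N c))"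

text \<open>
  The pair \<open>(i, t)\<close> stands for the event that voter \<open>i\<close> approves candidate \<open>t\<close>.
\<close>
definition approval_pmf :: "nat \<Rightarrow> nat \<Rightarrow> real \<Rightarrow> (nat \<times> nat \<Rightarrow> bool) pmf" where
  "approval_pmf n m p = Pi_pmf ({1..n} \<times> {1..m}) False (\<lambda>_. bernoulli_pmf p)"

definition random_profile :: "nat \<Rightarrow> nat \<Rightarrow> real \<Rightarrow> profile pmf" where
  "random_profile n m p = map_pmf (\<lambda>X t. {i \<in> {1..n}. X (i, t)}) (approval_pmf n m p)"

definition expected_score :: "nat \<Rightarrow> nat \<Rightarrow> nat \<Rightarrow> real \<Rightarrow> policy \<Rightarrow> real" where
  "expected_score n m k p \<pi> =
     measure_pmf.expectation (random_profile n m p)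
       (\<lambda>N. real (mav_score N (selected (terminal_history m k \<pi> N))))"

definition optimal_safe :: "nat \<Rightarrow> nat \<Rightarrow> nat \<Rightarrow> real \<Rightarrow> policy \<Rightarrow> bool" where
  "optimal_safe n m k p \<pi> \<longleftrightarrow>
     safe n m k \<pi> \<and>
     (\<forall>\<pi>'. safe n m k \<pi>' \<longrightarrow> expected_score n m k p \<pi>' \<le> expected_score n m k p \<pi>)"

type_synonym policy_table = "nat \<Rightarrow> nat \<Rightarrow> nat \<Rightarrow> action"

definition table_policy :: "policy_table \<Rightarrow> policy" where
  "table_policy T h A = T (length h + 1) (card (selected h)) (card A)"


section \<open>A real RAM\<close>

text \<open>
  Programs are written in a while language over two sorts of data, natural numbers (for counters
  and addresses) and real numbers, each with scalar variables and one-dimensional arrays.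
  A program is a finite piece of syntax that may not depend on the input, and
  the only constants in it are natural numbers. Reals can be compared but not rounded: no
  operation leads from real values to natural numbers other than branching. Subtraction of
  naturals is truncated, and division of reals by zero yields zero.
\<close>

type_synonym vname = string

datatype nexp =
    NConst nat
  | NVar vname
  | NArr vname nexp
  | NAdd nexp nexp
  | NSub nexp nexp
  | NMul nexp nexp

datatype rexp =
    ROf nexp
  | RVar vname
  | RArr vname nexp
  | RAdd rexp rexp
  | RSub rexp rexp
  | RMul rexp rexp
  | RDiv rexp rexp

datatype bexp =
    NLe nexp nexp
  | RLe rexp rexp
  | BNot bexp
  | BAnd bexp bexp

datatype com =
    Skip
  | NAssign vname nexp
  | NStore vname nexp nexp
  | RAssign vname rexp
  | RStore vname nexp rexp
  | Seq com com
  | If bexp com com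
  | While bexp com

record store =
  nvar :: "vname \<Rightarrow> nat"
  narr :: "vname \<Rightarrow> nat \<Rightarrow> nat"
  rvar :: "vname \<Rightarrow> real"
  rarr :: "vname \<Rightarrow> nat \<Rightarrow> real"

fun nval :: "nexp \<Rightarrow> store \<Rightarrow> nat" where
  "nval (NConst c) s = c"
| "nval (NVar x) s = nvar s x"
| "nval (NArr x e) s = narr s x (nval e s)"
| "nval (NAdd e f) s = nval e s + nval f s"
| "nval (NSub e f) s = nval e s - nval f s"
| "nval (NMul e f) s = nval e s * nval f s"

fun rval :: "rexp \<Rightarrow> store \<Rightarrow> real" where
  "rval (ROf e) s = real (nval e s)"
| "rval (RVar x) s = rvar s x"
| "rval (RArr x e) s = rarr s x (nval e s)"
| "rval (RAdd e f) s = rval e s + rval f s"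
| "rval (RSub e f) s = rval e s - rval f s"
| "rval (RMul e f) s = rval e s * rval f s"
| "rval (RDiv e f) s = rval e s / rval f s"

fun bval :: "bexp \<Rightarrow> store \<Rightarrow> bool" where
  "bval (NLe e f) s \<longleftrightarrow> nval e s \<le> nval f s"
| "bval (RLe e f) s \<longleftrightarrow> rval e s \<le> rval f s"
| "bval (BNot b) s \<longleftrightarrow> \<not> bval b s"
| "bval (BAnd b c) s \<longleftrightarrow> bval b s \<and> bval c s"

text \<open>
  Every constant, variable access, array access, arithmetic operation, comparison, connective,
  assignment and branch costs one unit. Both arguments of a conjunction are charged.
\<close>

fun ncost :: "nexp \<Rightarrow> nat" where
  "ncost (NConst c) = 1"
| "ncost (NVar x) = 1"
| "ncost (NArr x e) = 1 + ncost e"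
| "ncost (NAdd e f) = 1 + ncost e + ncost f"
| "ncost (NSub e f) = 1 + ncost e + ncost f"
| "ncost (NMul e f) = 1 + ncost e + ncost f"

fun rcost :: "rexp \<Rightarrow> nat" where
  "rcost (ROf e) = 1 + ncost e"
| "rcost (RVar x) = 1"
| "rcost (RArr x e) = 1 + ncost e"
| "rcost (RAdd e f) = 1 + rcost e + rcost f"
| "rcost (RSub e f) = 1 + rcost e + rcost f"
| "rcost (RMul e f) = 1 + rcost e + rcost f"
| "rcost (RDiv e f) = 1 + rcost e + rcost f"

fun bcost :: "bexp \<Rightarrow> nat" where
  "bcost (NLe e f) = 1 + ncost e + ncost f"
| "bcost (RLe e f) = 1 + rcost e + rcost f"
| "bcost (BNot b) = 1 + bcost b"
| "bcost (BAnd b c) = 1 + bcost b + bcost c"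

text \<open>
  \<open>exec c s t s'\<close>: started in store \<open>s\<close>, the program \<open>c\<close> halts in store \<open>s'\<close> after \<open>t\<close> units
  of time.
\<close>

inductive exec :: "com \<Rightarrow> store \<Rightarrow> nat \<Rightarrow> store \<Rightarrow> bool" where
  Skip: "exec Skip s 1 s"
| NAssign: "exec (NAssign x e) s (1 + ncost e) (s\<lparr>nvar := (nvar s)(x := nval e s)\<rparr>)"
| NStore: "exec (NStore x i e) s (1 + ncost i + ncost e)
    (s\<lparr>narr := (narr s)(x := (narr s x)(nval i s := nval e s))\<rparr>)"
| RAssign: "exec (RAssign x e) s (1 + rcost e) (s\<lparr>rvar := (rvar s)(x := rval e s)\<rparr>)"
| RStore: "exec (RStore x i e) s (1 + ncost i + rcost e)
    (s\<lparr>rarr := (rarr s)(x := (rarr s x)(nval i s := rval e s))\<rparr>)"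
| Seq: "exec c s t s' \<Longrightarrow> exec d s' u s'' \<Longrightarrow> exec (Seq c d) s (t + u) s''"
| IfTrue: "bval b s \<Longrightarrow> exec c s t s' \<Longrightarrow> exec (If b c d) s (1 + bcost b + t) s'"
| IfFalse: "\<not> bval b s \<Longrightarrow> exec d s t s' \<Longrightarrow> exec (If b c d) s (1 + bcost b + t) s'"
| WhileFalse: "\<not> bval b s \<Longrightarrow> exec (While b c) s (1 + bcost b) s"
| WhileTrue: "bval b s \<Longrightarrow> exec c s t s' \<Longrightarrow> exec (While b c) s' u s'' \<Longrightarrow>
    exec (While b c) s (1 + bcost b + t + u) s''"

lemma exec_deterministic:
  "exec c s t s' \<Longrightarrow> exec c s u s'' \<Longrightarrow> u = t \<and> s'' = s'"
proof (induction arbitrary: u s'' rule: exec.induct)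
  case Skip
  then show ?case by (auto elim: exec.cases)
next
  case NAssign
  then show ?case by (auto elim: exec.cases)
next
  case NStore
  then show ?case by (auto elim: exec.cases)
next
  case RAssign
  then show ?case by (auto elim: exec.cases)
next
  case RStore
  then show ?case by (auto elim: exec.cases)
next
  case Seq
  from Seq.prems show ?case by cases (use Seq.IH in blast)
next
  case IfTrue
  from IfTrue.prems show ?case by cases (use IfTrue in blast)+
next
  case IfFalse
  from IfFalse.prems show ?case by cases (use IfFalse in blast)+
next
  case WhileFalse
  from WhileFalse.prems show ?case by cases (use WhileFalse in blast)+
next
  case WhileTrue
  from WhileTrue.prems show ?case by cases (use WhileTrue in blast)+
qed


section \<open>Input and output conventions\<close>

text \<open>
  Nothing is assumed about the initial contents of the memory apart from the four input
  variables; in particular the output array need not be zero at the start.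
\<close>
definition input_store :: "nat \<Rightarrow> nat \<Rightarrow> nat \<Rightarrow> real \<Rightarrow> store \<Rightarrow> bool" where
  "input_store n m k p s \<longleftrightarrow>
     nvar s ''n'' = n \<and> nvar s ''m'' = m \<and> nvar s ''k'' = k \<and> rvar s ''p'' = p"

text \<open>
  The table is laid out row by row in one array, with 1 for yes and 0 for no.
\<close>
definition table_index :: "nat \<Rightarrow> nat \<Rightarrow> nat \<Rightarrow> nat \<Rightarrow> nat \<Rightarrow> nat" where
  "table_index n k \<alpha> \<beta> \<gamma> = (\<alpha> * (k + 1) + \<beta>) * (n + 1) + \<gamma>"

definition output_table :: "nat \<Rightarrow> nat \<Rightarrow> nat \<Rightarrow> policy_table \<Rightarrow> store \<Rightarrow> bool" where
  "output_table n m k T s \<longleftrightarrow>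
     (\<forall>\<alpha>\<in>{1..m}. \<forall>\<beta>\<in>{0..min k (\<alpha> - 1)}. \<forall>\<gamma>\<in>{0..n}.
        narr s ''table'' (table_index n k \<alpha> \<beta> \<gamma>) = (case T \<alpha> \<beta> \<gamma> of Yes \<Rightarrow> 1 | No \<Rightarrow> 0))"

end

theory Submission
  imports Defs
begin

text \<open>
  Let the value of a state be the best expected score obtainable from the \<open>r\<close> candidates still to
  come when \<open>j\<close> of them have to be selected. Since approval counts are independent and binomial,
  backward induction gives the values, and with them the table that accepts a candidate iff this is
  forced or at least as good as waiting. Score so far plus value of the state is a supermartingale
  under every safe policy, however it uses the history, and a martingale under the table, so the
  table is optimal. The binomial weights cost \<open>O(n\<^sup>2)\<close> by Pascal's rule, and each of the \<open>O(k m)\<close>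
  states costs \<open>O(n)\<close>.
\<close>

section \<open>Approval-count weights, values of states, and the table built from them\<close>

fun binomial_weight :: "real \<Rightarrow> nat \<Rightarrow> nat \<Rightarrow> real" where
  "binomial_weight p 0 g = (if g = 0 then 1 else 0)"
| "binomial_weight p (Suc i) 0 = (1 - p) * binomial_weight p i 0"
| "binomial_weight p (Suc i) (Suc g) =
     p * binomial_weight p i g + (1 - p) * binomial_weight p i (Suc g)"

text \<open>Conditioning on the last of \<open>i\<close> trials is Pascal's rule. The recursive form
  is the one tabulated by the program, with constant work per entry.\<close>

lemma binomial_weight_eq:
  "binomial_weight p i g = real (i choose g) * p ^ g * (1 - p) ^ (i - g)"
proof (induction p i g rule: binomial_weight.induct)
  case (3 p i g)
  show ?case
  proof (cases "g < i")
    case True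
    then obtain d where "i = Suc (g + d)"
      using less_iff_Suc_add by auto
    then show ?thesis
      unfolding binomial_weight.simps 3 by (simp add: algebra_simps)
  next
    case False
    with 3 show ?thesis
      by (cases "g = i") (simp_all add: binomial_eq_0)
  qed
qed auto

text \<open>
  \<open>opt_value n p r j\<close> is the best expected score obtainable from \<open>r\<close> remaining candidates of which
  exactly \<open>j\<close> have to be selected. For \<open>j > r\<close> this is impossible and the value is junk; the test
  \<open>r < Suc j\<close> forces acceptance where rejecting would lead there.
\<close>
fun opt_value :: "nat \<Rightarrow> real \<Rightarrow> nat \<Rightarrow> nat \<Rightarrow> real" where
  "opt_value n p 0 j = 0"
| "opt_value n p (Suc r) 0 = 0"
| "opt_value n p (Suc r) (Suc j) =
     (\<Sum>g\<le>n. binomial_weight p n g *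
        (if r < Suc j \<or> opt_value n p r (Suc j) \<le> real g + opt_value n p r j
         then real g + opt_value n p r j else opt_value n p r (Suc j)))"

text \<open>\<open>r\<close> counts the candidates after the current one, while \<open>j\<close>
  includes the selection now under decision; \<open>r < j\<close> thus says that rejecting would
  leave too few. Ties are accepted.\<close>

definition accepts :: "nat \<Rightarrow> real \<Rightarrow> nat \<Rightarrow> nat \<Rightarrow> nat \<Rightarrow> bool" where
  "accepts n p r j g \<longleftrightarrow>
     r < j \<or> opt_value n p r j \<le> real g + opt_value n p r (j - 1)"

text \<open>The guard \<open>\<beta> < k\<close> matters: at \<open>j = 0\<close> the truncated
  \<open>j - 1\<close> would make \<open>accepts\<close> true although the committee is
  full.\<close>

definition opt_table :: "nat \<Rightarrow> nat \<Rightarrow> nat \<Rightarrow> real \<Rightarrow> policy_table" where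
  "opt_table n m k p \<alpha> \<beta> \<gamma> =
     (if \<beta> < k \<and> accepts n p (m - \<alpha>) (k - \<beta>) \<gamma> then Yes else No)"

lemma opt_value_not_needed [simp]: "opt_value n p r 0 = 0"
  by (cases r) simp_all

section \<open>Profiles as sequences of independent approval sets\<close>

definition approvers_pmf :: "nat \<Rightarrow> real \<Rightarrow> nat set pmf" where
  "approvers_pmf n p =
     map_pmf (\<lambda>f. {i \<in> {1..n}. f i}) (Pi_pmf {1..n} False (\<lambda>_. bernoulli_pmf p))"

lemma random_profile_0: "random_profile n 0 p = return_pmf (\<lambda>_. {})"
  by (simp add: random_profile_def approval_pmf_def)

text \<open>Independence enters here: splitting the index set into the newest column and the earlier
  ones factors the product measure, so approval sets can be revealed one at a time.\<close>

lemma random_profile_Suc: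
  "random_profile n (Suc t) p =
     map_pmf (\<lambda>(A, N). N(Suc t := A)) (pair_pmf (approvers_pmf n p) (random_profile n t p))"
proof -
  let ?A = "{1..n} \<times> {Suc t}" and ?B = "{1..n} \<times> {1..t}"
  let ?P = "\<lambda>S :: (nat \<times> nat) set. Pi_pmf S False (\<lambda>_. bernoulli_pmf p)"
  have AB: "{1..n} \<times> {1..Suc t} = ?A \<union> ?B"
    by auto
  have union: "?P (?A \<union> ?B) =
      map_pmf (\<lambda>(f, g) x. if x \<in> ?A then f x else g x) (pair_pmf (?P ?A) (?P ?B))"
    by (rule Pi_pmf_union) auto
  have "Pi_pmf {1..n} False (\<lambda>_. bernoulli_pmf p) = map_pmf (\<lambda>g. g \<circ> (\<lambda>i. (i, Suc t))) (?P ?A)"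
    by (rule Pi_pmf_bij_betw) (auto simp: bij_betw_def inj_on_def)
  then have approvers: "approvers_pmf n p = map_pmf (\<lambda>g. {i \<in> {1..n}. g (i, Suc t)}) (?P ?A)"
    by (simp add: approvers_pmf_def pmf.map_comp o_def)
  show ?thesis
    unfolding random_profile_def approval_pmf_def AB union approvers map_pair[symmetric]
      pmf.map_comp
    by (intro map_pmf_cong refl) (auto simp: fun_eq_iff split: if_splits)
qed

lemma finite_set_approvers_pmf: "finite (set_pmf (approvers_pmf n p))"
  by (rule finite_subset[of _ "Pow {1..n}"]) (auto simp: approvers_pmf_def)

lemma set_approvers_pmf: "A \<in> set_pmf (approvers_pmf n p) \<Longrightarrow> A \<subseteq> {1..n}"
  by (auto simp: approvers_pmf_def)

lemma finite_set_random_profile: "finite (set_pmf (random_profile n t p))"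
  by (induction t) (simp_all add: random_profile_0 random_profile_Suc finite_set_approvers_pmf)

lemma set_random_profile: "N \<in> set_pmf (random_profile n t p) \<Longrightarrow> profile_on n m N"
  by (auto simp: random_profile_def profile_on_def)

text \<open>Fubini for finite supports. The first component is integrated innermost, as when
  averaging over a new approval set with the earlier ones fixed.\<close>

lemma expectation_pair_pmf_finite:
  fixes f :: "'a \<times> 'b \<Rightarrow> real"
  assumes "finite (set_pmf P)" and "finite (set_pmf Q)"
  shows "measure_pmf.expectation (pair_pmf P Q) f =
           measure_pmf.expectation Q (\<lambda>y. measure_pmf.expectation P (\<lambda>x. f (x, y)))"
proof -
  have "pair_pmf P Q = Q \<bind> (\<lambda>y. P \<bind> (\<lambda>x. return_pmf (x, y)))"
    unfolding pair_pmf_def by (rule bind_commute_pmf)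
  also have "\<dots> = Q \<bind> (\<lambda>y. map_pmf (\<lambda>x. (x, y)) P)"
    by (simp add: map_pmf_def)
  finally have "measure_pmf.expectation (pair_pmf P Q) f =
      (\<Sum>y\<in>set_pmf Q. pmf Q y *\<^sub>R measure_pmf.expectation (map_pmf (\<lambda>x. (x, y)) P) f)"
    using assms by (simp add: pmf_expectation_bind[where A = "set_pmf Q"])
  also have "\<dots> = measure_pmf.expectation Q (\<lambda>y. measure_pmf.expectation P (\<lambda>x. f (x, y)))"
    using assms by (subst integral_measure_pmf[of "set_pmf Q"]) auto
  finally show ?thesis .
qed

lemma expectation_random_profile_Suc:
  fixes f :: "profile \<Rightarrow> real"
  shows "measure_pmf.expectation (random_profile n (Suc t) p) f =
    measure_pmf.expectation (random_profile n t p)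
      (\<lambda>N. measure_pmf.expectation (approvers_pmf n p) (\<lambda>A. f (N(Suc t := A))))"
  by (simp add: random_profile_Suc expectation_pair_pmf_finite finite_set_approvers_pmf
      finite_set_random_profile)

text \<open>The size of a random approval set is binomially distributed.\<close>

lemma expectation_approvers_pmf:
  fixes f :: "nat \<Rightarrow> real"
  assumes "0 \<le> p" and "p \<le> 1"
  shows "measure_pmf.expectation (approvers_pmf n p) (\<lambda>A. f (card A)) =
    (\<Sum>g\<le>n. binomial_weight p n g * f g)"
proof -
  have "map_pmf card (approvers_pmf n p) = binomial_pmf n p"
    using assms
    by (subst binomial_pmf_altdef'[of "{1..n}" n p False])
      (auto simp: approvers_pmf_def pmf.map_comp o_def)
  then have "measure_pmf.expectation (approvers_pmf n p) (\<lambda>A. f (card A)) =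
      measure_pmf.expectation (binomial_pmf n p) f"
    by (metis integral_map_pmf)
  also have "\<dots> = (\<Sum>g\<le>n. pmf (binomial_pmf n p) g *\<^sub>R f g)"
    using set_pmf_binomial_eq[of p n] assms
    by (intro integral_measure_pmf) (auto split: if_splits)
  also have "\<dots> = (\<Sum>g\<le>n. binomial_weight p n g * f g)"
    using assms by (simp add: binomial_weight_eq)
  finally show ?thesis .
qed

section \<open>Optimality of the table policy\<close>

lemma finite_selected: "finite (selected h)"
  by (rule finite_subset[of _ "fst ` set h"]) (force simp: selected_def)+

lemma selected_snoc:
  "selected (h @ [(c, A, a)]) = (if a = Yes then insert c (selected h) else selected h)"
  by (auto simp: selected_def)

text \<open>Terminal histories are absorbing, so a nonterminal one has been extended in every
  round.\<close>

lemma length_play_nonterminal: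
  "\<not> terminal m k (play m k \<pi> N t) \<Longrightarrow> length (play m k \<pi> N t) = t"
  by (induction t) (auto simp: Let_def split: if_splits)

lemma length_play_le_m: "length (play m k \<pi> N t) \<le> m"
proof (induction t)
  case (Suc t)
  then show ?case
    by (auto simp: Let_def terminal_def dest: le_neq_implies_less)
qed simp

lemma selected_play_le: "c \<in> selected (play m k \<pi> N t) \<Longrightarrow> c \<le> t"
proof (induction t)
  case (Suc t)
  then show ?case
    by (auto simp: Let_def selected_snoc le_SucI split: if_splits)
qed (simp add: selected_def)

lemma Suc_notin_selected_play: "Suc t \<notin> selected (play m k \<pi> N t)"
  using selected_play_le by fastforce

text \<open>The online property: later approval sets can be changed without affecting the
  past.\<close>

lemma play_cong: "(\<And>c. c \<le> t \<Longrightarrow> N c = N' c) \<Longrightarrow> play m k \<pi> N t = play m k \<pi> N' t"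
  by (induction t) (simp_all add: Let_def)

lemma terminal_play: "terminal m k (play m k \<pi> N m)"
  using length_play_nonterminal terminal_def by blast

lemma card_selected_play_snoc:
  "card (selected (play m k \<pi> N t @ [(Suc t, A, a)])) =
     card (selected (play m k \<pi> N t)) + (if a = Yes then 1 else 0)"
  by (simp add: selected_snoc finite_selected Suc_notin_selected_play)

text \<open>Read off the history alone, so that it also applies to a history prolonged by a
  hypothetical approval set.\<close>

definition history_score :: "history \<Rightarrow> real" where
  "history_score h = (\<Sum>(c, A, a)\<leftarrow>h. if a = Yes then real (card A) else 0)"

lemma mav_score_play:
  "real (mav_score N (selected (play m k \<pi> N t))) = history_score (play m k \<pi> N t)"
proof (induction t)
  case 0
  show ?case
    by (simp add: mav_score_def selected_def history_score_def)
next
  case (Suc t)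
  then show ?case
    by (simp add: Let_def selected_snoc history_score_def mav_score_def finite_selected
        Suc_notin_selected_play)
qed

section \<open>Histories from which exactly \<open>k\<close> selections are still attainable\<close>

definition feasible :: "nat \<Rightarrow> nat \<Rightarrow> history \<Rightarrow> bool" where
  "feasible m k h \<longleftrightarrow>
     card (selected h) \<le> k \<and> k \<le> card (selected h) + (m - length h)"

text \<open>Infeasibility is irreversible: a round adds at most one selection and uses up one
  remaining candidate.\<close>

lemma feasible_play_Suc_D:
  assumes "feasible m k (play m k \<pi> N (Suc t))"
  shows "feasible m k (play m k \<pi> N t)"
  using assms length_play_le_m[of m k \<pi> N t]
  by (auto simp: Let_def feasible_def terminal_def card_selected_play_snoc split: if_splits)

text \<open>Safety constrains only the final history; induction backwards from time \<open>m\<close>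
  carries it to every prefix.\<close>

lemma safe_feasible:
  assumes "safe n m k \<pi>" and "profile_on n m N" and "t \<le> m"
  shows "feasible m k (play m k \<pi> N t)"
  using assms(3)
proof (induction rule: inc_induct)
  case base
  then show ?case
    using assms(1,2) by (simp add: safe_def terminal_history_def feasible_def)
next
  case (step t)
  then show ?case
    using feasible_play_Suc_D by blast
qed

definition potential :: "nat \<Rightarrow> nat \<Rightarrow> nat \<Rightarrow> real \<Rightarrow> history \<Rightarrow> real" where
  "potential n m k p h =
     history_score h + opt_value n p (m - length h) (k - card (selected h))"

text \<open>Either no candidate remains or nothing is left to select, and both give the value
  \<open>0\<close>.\<close>

lemma potential_terminal: "terminal m k h \<Longrightarrow> potential n m k p h = history_score h"
  by (auto simp: terminal_def potential_def)

text \<open>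
  The score so far plus the value of the remaining problem is a supermartingale along the play
  of a safe policy, and a martingale along the play of the table policy.
\<close>
lemma potential_step:
  fixes n m k t :: nat and p :: real and N :: profile and \<pi> :: policy
  assumes p: "0 \<le> p" "p \<le> 1"
    and h: "h = play m k \<pi> N t" "\<not> terminal m k h" "feasible m k h"
  defines "V \<equiv> \<lambda>A. potential n m k p (h @ [(Suc t, A, \<pi> h A)])"
    and "W \<equiv> \<lambda>A. potential n m k p (h @ [(Suc t, A, table_policy (opt_table n m k p) h A)])"
  shows "measure_pmf.expectation (approvers_pmf n p) W = potential n m k p h"
    and "feasible m k (h @ [(Suc t, A, \<pi> h A)]) \<Longrightarrow> V A \<le> W A"
proof -
  have len: "length h = t" "t < m"
    using h length_play_nonterminal[of m k \<pi> N t] length_play_le_m[of m k \<pi> N t]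
    by (auto simp: terminal_def)
  have sel: "card (selected h) < k"
    using h by (auto simp: feasible_def terminal_def)
  \<comment> \<open>A nonterminal feasible history has a candidate and a selection left, so the last
    equation of \<open>opt_value\<close> applies.\<close>
  obtain r where r: "m - t = Suc r"
    using len by (metis Suc_diff_Suc)
  obtain j where j: "k - card (selected h) = Suc j"
    using sel by (metis Suc_diff_Suc)
  have r': "m - Suc t = r" and j': "k - Suc (card (selected h)) = j"
    using r j by auto
  have step: "potential n m k p (h @ [(Suc t, A, a)]) = history_score h +
      (if a = Yes then real (card A) + opt_value n p r j else opt_value n p r (Suc j))" for A a
    using card_selected_play_snoc[of m k \<pi> N t A a] len r' j j'
    by (simp add: potential_def history_score_def flip: h(1))
  have table: "table_policy (opt_table n m k p) h A = Yes \<longleftrightarrow>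
      r < Suc j \<or> opt_value n p r (Suc j) \<le> real (card A) + opt_value n p r j" for A
    using sel len r' j by (simp add: table_policy_def opt_table_def accepts_def)
  have "measure_pmf.expectation (approvers_pmf n p) W =
      (\<Sum>g\<le>n. binomial_weight p n g * (history_score h +
        (if r < Suc j \<or> opt_value n p r (Suc j) \<le> real g + opt_value n p r j
         then real g + opt_value n p r j else opt_value n p r (Suc j))))"
    unfolding W_def step table
    using expectation_approvers_pmf[OF p, of n "\<lambda>g. history_score h +
        (if r < Suc j \<or> opt_value n p r (Suc j) \<le> real g + opt_value n p r j
         then real g + opt_value n p r j else opt_value n p r (Suc j))"] by simp
  also have "\<dots> = history_score h * (\<Sum>g\<le>n. binomial_weight p n g) + opt_value n p (Suc r) (Suc j)"
    by (simp add: distrib_left sum.distrib sum_distrib_left mult.commute)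
  also have "(\<Sum>g\<le>n. binomial_weight p n g) = 1"
    using expectation_approvers_pmf[OF p, of n "\<lambda>_. 1"] by simp
  finally show "measure_pmf.expectation (approvers_pmf n p) W = potential n m k p h"
    using len r j by (simp add: potential_def)
  show "V A \<le> W A" if "feasible m k (h @ [(Suc t, A, \<pi> h A)])"
  proof -
    \<comment> \<open>Feasibility of the successor forces acceptance when too few candidates remain;
      otherwise the table takes the larger of the two values.\<close>
    have "\<pi> h A = Yes" if "r < Suc j"
      using \<open>feasible m k (h @ [(Suc t, A, \<pi> h A)])\<close> that r' j len
        card_selected_play_snoc[of m k \<pi> N t A "\<pi> h A"]
      by (auto simp: feasible_def simp flip: h(1) split: if_splits)
    then show ?thesis
      unfolding V_def W_def step table by auto
  qed
qed

lemma play_fun_upd: "play m k \<pi> (N(Suc t := A)) t = play m k \<pi> N t"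
  by (rule play_cong) auto

lemma play_Suc_fun_upd:
  "play m k \<pi> (N(Suc t := A)) (Suc t) =
     (let h = play m k \<pi> N t in if terminal m k h then h else h @ [(Suc t, A, \<pi> h A)])"
  by (simp add: play_fun_upd Let_def)

lemma profile_on_fun_upd: "profile_on n m N \<Longrightarrow> A \<subseteq> {1..n} \<Longrightarrow> profile_on n m (N(t := A))"
  by (auto simp: profile_on_def)

lemma expectation_mono_finite:
  fixes f g :: "'a \<Rightarrow> real"
  assumes "finite (set_pmf P)" and "\<And>x. x \<in> set_pmf P \<Longrightarrow> f x \<le> g x"
  shows "measure_pmf.expectation P f \<le> measure_pmf.expectation P g"
  using assms by (intro integral_mono_AE integrable_measure_pmf_finite) (auto intro: AE_pmfI)

lemma expected_score_eq_potential:
  "expected_score n m k p \<pi> =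
     measure_pmf.expectation (random_profile n m p) (\<lambda>N. potential n m k p (play m k \<pi> N m))"
  by (simp add: expected_score_def terminal_history_def mav_score_play potential_terminal
      terminal_play)

text \<open>Averaging over approval set \<open>Suc t\<close>, with the first \<open>t\<close> sets
  fixed, never raises the potential; at time \<open>0\<close> it is the value of the whole
  problem.\<close>

lemma safe_expected_potential_le:
  assumes p: "0 \<le> p" "p \<le> 1" and safe: "safe n m k \<pi>" and "t \<le> m"
  shows "measure_pmf.expectation (random_profile n t p)
           (\<lambda>N. potential n m k p (play m k \<pi> N t)) \<le> potential n m k p []"
  using \<open>t \<le> m\<close>
proof (induction t)
  case 0
  then show ?case
    by (simp add: random_profile_0)
next
  case (Suc t)
  have "measure_pmf.expectation (random_profile n (Suc t) p)
      (\<lambda>N. potential n m k p (play m k \<pi> N (Suc t))) \<le>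
      measure_pmf.expectation (random_profile n t p)
      (\<lambda>N. potential n m k p (play m k \<pi> N t))"
    unfolding expectation_random_profile_Suc
  proof (rule expectation_mono_finite[OF finite_set_random_profile])
    fix N
    assume "N \<in> set_pmf (random_profile n t p)"
    then have N: "profile_on n m N"
      by (rule set_random_profile)
    define h where "h = play m k \<pi> N t"
    have h: "feasible m k h"
      unfolding h_def using safe N Suc.prems by (intro safe_feasible) auto
    show "measure_pmf.expectation (approvers_pmf n p)
        (\<lambda>A. potential n m k p (play m k \<pi> (N(Suc t := A)) (Suc t))) \<le>
        potential n m k p (play m k \<pi> N t)"
    proof (cases "terminal m k h")
      case True
      then show ?thesis
        unfolding play_Suc_fun_upd by (simp add: h_def)
    next
      case False
      \<comment> \<open>Safety speaks only about approval sets inside \<open>{1..n}\<close>, hence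
        the restriction to the support.\<close>
      have "feasible m k (h @ [(Suc t, A, \<pi> h A)])" if "A \<in> set_pmf (approvers_pmf n p)" for A
        using safe_feasible[OF safe profile_on_fun_upd[OF N set_approvers_pmf[OF that]] Suc.prems,
            of "Suc t"] False
        unfolding play_Suc_fun_upd by (simp add: h_def Let_def)
      then have "measure_pmf.expectation (approvers_pmf n p)
          (\<lambda>A. potential n m k p (h @ [(Suc t, A, \<pi> h A)])) \<le> potential n m k p h"
        unfolding potential_step(1)[OF p h_def False h, symmetric]
        by (intro expectation_mono_finite finite_set_approvers_pmf
            potential_step(2)[OF p h_def False h])
      then show ?thesis
        using False unfolding play_Suc_fun_upd by (simp add: h_def Let_def)
    qed
  qed
  with Suc show ?case
    by linarith
qed

lemma opt_table_feasible:
  assumes "k \<le> m"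
  shows "feasible m k (play m k (table_policy (opt_table n m k p)) N t)"
proof (induction t)
  case 0
  with assms show ?case
    by (simp add: feasible_def selected_def)
next
  case (Suc t)
  let ?\<pi> = "table_policy (opt_table n m k p)"
  let ?h = "play m k ?\<pi> N t"
  show ?case
  proof (cases "terminal m k ?h")
    case True
    with Suc show ?thesis
      by simp
  next
    case False
    then have len: "length ?h = t" "t < m"
      using length_play_nonterminal[of m k ?\<pi> N t] length_play_le_m[of m k ?\<pi> N t]
      by (auto simp: terminal_def)
    have sel: "card (selected ?h) < k"
      using False Suc by (auto simp: feasible_def terminal_def)
    \<comment> \<open>Only a rejection can lose attainability, and the forced clause of
      \<open>accepts\<close> excludes the harmful ones.\<close>
    have "k \<le> card (selected ?h) + (m - Suc t)" if "?\<pi> ?h (N (Suc t)) \<noteq> Yes"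
    proof (rule ccontr)
      assume "\<not> ?thesis"
      then have "m - Suc t < k - card (selected ?h)"
        by linarith
      then have "accepts n p (m - Suc t) (k - card (selected ?h)) (card (N (Suc t)))"
        by (simp add: accepts_def)
      with that sel len show False
        by (simp add: table_policy_def opt_table_def)
    qed
    then show ?thesis
      using Suc False len sel by (auto simp: feasible_def Let_def card_selected_play_snoc)
  qed
qed

lemma opt_table_safe: "k \<le> m \<Longrightarrow> safe n m k (table_policy (opt_table n m k p))"
  unfolding safe_def terminal_history_def
proof (intro allI impI)
  fix N
  assume "k \<le> m"
  then show "card (selected (play m k (table_policy (opt_table n m k p)) N m)) = k"
    using opt_table_feasible[of k m n p N m]
      terminal_play[of m k "table_policy (opt_table n m k p)" N]
    unfolding feasible_def terminal_def by auto
qed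

lemma opt_table_expected_potential:
  assumes p: "0 \<le> p" "p \<le> 1" and "k \<le> m"
  shows "measure_pmf.expectation (random_profile n t p)
           (\<lambda>N. potential n m k p (play m k (table_policy (opt_table n m k p)) N t)) =
         potential n m k p []"
proof (induction t)
  case 0
  show ?case
    by (simp add: random_profile_0)
next
  case (Suc t)
  let ?\<pi> = "table_policy (opt_table n m k p)"
  have "measure_pmf.expectation (approvers_pmf n p)
      (\<lambda>A. potential n m k p (play m k ?\<pi> (N(Suc t := A)) (Suc t))) =
      potential n m k p (play m k ?\<pi> N t)" for N
  proof (cases "terminal m k (play m k ?\<pi> N t)")
    case True
    then show ?thesis
      unfolding play_Suc_fun_upd by simp
  next
    case False
    then show ?thesis
      using potential_step(1)[OF p refl False opt_table_feasible[OF \<open>k \<le> m\<close>]]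
      unfolding play_Suc_fun_upd by (simp add: Let_def)
  qed
  with Suc show ?case
    unfolding expectation_random_profile_Suc by simp
qed

text \<open>\<open>potential n m k p []\<close> bounds the expected score of every safe policy, and
  the table attains it.\<close>

lemma opt_table_optimal:
  assumes "0 \<le> p" and "p \<le> 1" and "k \<le> m"
  shows "optimal_safe n m k p (table_policy (opt_table n m k p))"
  unfolding optimal_safe_def expected_score_eq_potential
  using assms by (simp add: opt_table_safe opt_table_expected_potential safe_expected_potential_le)

section \<open>Total correctness with time bounds\<close>

definition runs :: "(store \<Rightarrow> bool) \<Rightarrow> com \<Rightarrow> nat \<Rightarrow> (store \<Rightarrow> bool) \<Rightarrow> bool" where
  "runs P c b Q \<longleftrightarrow> (\<forall>s. P s \<longrightarrow> (\<exists>t s'. exec c s t s' \<and> t \<le> b \<and> Q s'))"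

lemma runs_Seq:
  assumes "runs P c b Q" and "runs Q d b' R"
  shows "runs P (Seq c d) (b + b') R"
  using assms unfolding runs_def by (meson exec.Seq add_mono)

lemma runs_mono: "runs P c b Q \<Longrightarrow> b \<le> b' \<Longrightarrow> runs P c b' Q"
  unfolding runs_def by (meson order_trans)

text \<open>Indexing the invariant by the number of iterations left gives termination; the guard is
  evaluated once more often than the body.\<close>

lemma runs_While:
  assumes guard: "\<And>i s. I i s \<Longrightarrow> bval g s \<longleftrightarrow> 0 < i"
    and body: "\<And>i. runs (I (Suc i)) c b (I i)"
  shows "runs (I l) (While g c) ((l + 1) * (1 + bcost g) + l * b) (I 0)"
proof (induction l)
  case 0
  then show ?case
    unfolding runs_def using guard by (fastforce intro: exec.WhileFalse)
next
  case (Suc l)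
  show ?case
    unfolding runs_def
  proof (intro allI impI)
    fix s
    assume s: "I (Suc l) s"
    then obtain t s' where 1: "exec c s t s'" "t \<le> b" "I l s'"
      using body unfolding runs_def by blast
    then obtain u s'' where 2: "exec (While g c) s' u s''"
        "u \<le> (l + 1) * (1 + bcost g) + l * b" "I 0 s''"
      using Suc unfolding runs_def by blast
    have "exec (While g c) s (1 + bcost g + t + u) s''"
      using s guard 1(1) 2(1) by (intro exec.WhileTrue) auto
    moreover have "1 + bcost g + t + u \<le> (Suc l + 1) * (1 + bcost g) + Suc l * b"
      using 1(2) 2(2) by simp
    ultimately show "\<exists>t s'. exec (While g c) s t s' \<and>
        t \<le> (Suc l + 1) * (1 + bcost g) + Suc l * b \<and> I 0 s'"
      using 2(3) by blast
  qed
qed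

text \<open>Only meaningful for loop-free programs: a loop gets the junk value \<^const>\<open>False\<close>.\<close>
fun wp :: "com \<Rightarrow> (store \<Rightarrow> bool) \<Rightarrow> store \<Rightarrow> bool" where
  "wp Skip Q s = Q s"
| "wp (NAssign x e) Q s = Q (s\<lparr>nvar := (nvar s)(x := nval e s)\<rparr>)"
| "wp (NStore x i e) Q s =
     Q (s\<lparr>narr := (narr s)(x := (narr s x)(nval i s := nval e s))\<rparr>)"
| "wp (RAssign x e) Q s = Q (s\<lparr>rvar := (rvar s)(x := rval e s)\<rparr>)"
| "wp (RStore x i e) Q s =
     Q (s\<lparr>rarr := (rarr s)(x := (rarr s x)(nval i s := rval e s))\<rparr>)"
| "wp (Seq c d) Q s = wp c (wp d Q) s"
| "wp (If g c d) Q s = (if bval g s then wp c Q s else wp d Q s)"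
| "wp (While g c) Q s = False"

text \<open>The \<open>0\<close> for loops is harmless, since \<open>wp\<close> is
  \<open>False\<close> there.\<close>

fun max_cost :: "com \<Rightarrow> nat" where
  "max_cost Skip = 1"
| "max_cost (NAssign x e) = 1 + ncost e"
| "max_cost (NStore x i e) = 1 + ncost i + ncost e"
| "max_cost (RAssign x e) = 1 + rcost e"
| "max_cost (RStore x i e) = 1 + ncost i + rcost e"
| "max_cost (Seq c d) = max_cost c + max_cost d"
| "max_cost (If g c d) = 1 + bcost g + max (max_cost c) (max_cost d)"
| "max_cost (While g c) = 0"

lemma wp_exec: "wp c Q s \<Longrightarrow> \<exists>t s'. exec c s t s' \<and> t \<le> max_cost c \<and> Q s'"
proof (induction c arbitrary: Q s)
  case (Seq c d)
  then obtain t s' where 1: "exec c s t s'" "t \<le> max_cost c" "wp d Q s'"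
    by fastforce
  with Seq obtain u s'' where 2: "exec d s' u s''" "u \<le> max_cost d" "Q s''"
    by blast
  show ?case
    using exec.Seq[OF 1(1) 2(1)] 1(2) 2(2,3) by (auto intro!: exI add_mono)
next
  case (If g c d)
  show ?case
  proof (cases "bval g s")
    case True
    with If obtain t s' where "exec c s t s'" "t \<le> max_cost c" "Q s'"
      by fastforce
    with True show ?thesis
      using exec.IfTrue[OF True] by (fastforce simp: le_max_iff_disj)
  next
    case False
    with If obtain t s' where "exec d s t s'" "t \<le> max_cost d" "Q s'"
      by fastforce
    with False show ?thesis
      using exec.IfFalse[OF False] by (fastforce simp: le_max_iff_disj)
  qed
qed (fastforce intro: exec.intros)+

lemma runs_wp: "(\<And>s. P s \<Longrightarrow> wp c Q s) \<Longrightarrow> max_cost c \<le> b \<Longrightarrow> runs P c b Q"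
  unfolding runs_def using wp_exec order_trans by metis

text \<open>Every loop of the program counts a variable down to zero. Its guard costs
  \<open>3\<close> and the branch \<open>1\<close>, whence the factor \<open>4\<close>.\<close>

lemma runs_countdown:
  assumes start: "\<And>s. P s \<Longrightarrow> I l s" and counter: "\<And>i s. I i s \<Longrightarrow> nvar s x = i"
    and body: "\<And>i. runs (I (Suc i)) c b (I i)" and stop: "\<And>s. I 0 s \<Longrightarrow> Q s"
  shows "runs P (While (NLe (NConst 1) (NVar x)) c) ((l + 1) * 4 + l * b) Q"
proof -
  have "runs (I l) (While (NLe (NConst 1) (NVar x)) c)
      ((l + 1) * (1 + bcost (NLe (NConst 1) (NVar x))) + l * b) (I 0)"
    by (rule runs_While) (use counter body in fastforce)+
  then show ?thesis
    using start stop unfolding runs_def by (fastforce simp: numeral_eq_Suc)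
qed

section \<open>The program\<close>

abbreviation positive :: "vname \<Rightarrow> bexp" where
  "positive x \<equiv> NLe (NConst 1) (NVar x)"

abbreviation decrement :: "vname \<Rightarrow> com" where
  "decrement x \<equiv> NAssign x (NSub (NVar x) (NConst 1))"

definition weights_clear :: com where
  "weights_clear = Seq (RStore ''B'' (NVar ''g'') (ROf (NConst 0))) (decrement ''g'')"

definition weights_update :: com where
  "weights_update = Seq
     (RStore ''B'' (NVar ''g'')
       (RAdd (RMul (RVar ''p'') (RArr ''B'' (NSub (NVar ''g'') (NConst 1))))
         (RMul (RSub (ROf (NConst 1)) (RVar ''p'')) (RArr ''B'' (NVar ''g'')))))
     (decrement ''g'')"

text \<open>Running downwards through the array lets Pascal's rule work in place.\<close>
definition weights_row :: com where
  "weights_row = Seq (NAssign ''g'' (NVar ''n'')) (Seq (While (positive ''g'') weights_update)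
     (Seq (RStore ''B'' (NConst 0)
            (RMul (RSub (ROf (NConst 1)) (RVar ''p'')) (RArr ''B'' (NConst 0))))
       (decrement ''i'')))"

definition weights_prog :: com where
  "weights_prog = Seq (NAssign ''g'' (NVar ''n'')) (Seq (While (positive ''g'') weights_clear)
     (Seq (Seq (RStore ''B'' (NConst 0) (ROf (NConst 1))) (NAssign ''i'' (NVar ''n'')))
       (While (positive ''i'') weights_row)))"

definition table_clear :: com where
  "table_clear = Seq (decrement ''z'') (NStore ''table'' (NVar ''z'') (NConst 0))"

definition values_clear :: com where
  "values_clear = Seq (RStore ''V'' (NVar ''j'') (ROf (NConst 0))) (decrement ''j'')"

text \<open>Memory starts arbitrary and later only ones are written to the table, so zeros come
  first. Zeros in \<open>''V''\<close> are the values with no candidate left.\<close>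

definition clear_prog :: com where
  "clear_prog = Seq
     (NAssign ''z'' (NMul (NMul (NAdd (NVar ''m'') (NConst 1)) (NAdd (NVar ''k'') (NConst 1)))
       (NAdd (NVar ''n'') (NConst 1))))
     (Seq (While (positive ''z'') table_clear)
       (Seq (Seq (RStore ''V'' (NConst 0) (ROf (NConst 0))) (NAssign ''j'' (NVar ''k'')))
         (While (positive ''j'') values_clear)))"

definition accept_value :: rexp where
  "accept_value = RAdd (ROf (NVar ''g'')) (RArr ''V'' (NSub (NVar ''j'') (NConst 1)))"

definition reject_value :: rexp where
  "reject_value = RArr ''V'' (NVar ''j'')"

text \<open>The language has no disjunction, hence De Morgan. For \<open>a \<le> m\<close>, the test
  \<open>m - a < j\<close> becomes \<open>m + 1 \<le> a + j\<close>, without truncated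
  subtraction.\<close>

definition accept_test :: bexp where
  "accept_test = BNot (BAnd
     (BNot (NLe (NAdd (NVar ''m'') (NConst 1)) (NAdd (NVar ''a'') (NVar ''j''))))
     (BNot (RLe reject_value accept_value)))"

definition current_index :: nexp where
  "current_index = NAdd (NMul
     (NAdd (NMul (NVar ''a'') (NAdd (NVar ''k'') (NConst 1))) (NSub (NVar ''k'') (NVar ''j'')))
     (NAdd (NVar ''n'') (NConst 1))) (NVar ''g'')"

lemma nval_current_index [simp]: "nval current_index s =
    table_index (nvar s ''n'') (nvar s ''k'') (nvar s ''a'') (nvar s ''k'' - nvar s ''j'')
      (nvar s ''g'')"
  by (simp add: current_index_def table_index_def)

lemma ncost_current_index [simp]: "ncost current_index = 15"
  by (simp add: current_index_def)

lemma rval_accept_value [simp]: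
  "rval accept_value s = real (nvar s ''g'') + rarr s ''V'' (nvar s ''j'' - 1)"
  by (simp add: accept_value_def)

lemma rval_reject_value [simp]: "rval reject_value s = rarr s ''V'' (nvar s ''j'')"
  by (simp add: reject_value_def)

lemma rcost_accept_value [simp]: "rcost accept_value = 7"
  by (simp add: accept_value_def)

lemma rcost_reject_value [simp]: "rcost reject_value = 2"
  by (simp add: reject_value_def)

lemma bval_accept_test [simp]: "bval accept_test s \<longleftrightarrow> nvar s ''m'' < nvar s ''a'' + nvar s ''j'' \<or>
    rarr s ''V'' (nvar s ''j'') \<le> real (nvar s ''g'') + rarr s ''V'' (nvar s ''j'' - 1)"
  by (auto simp: accept_test_def)

lemma bcost_accept_test [simp]: "bcost accept_test = 21"
  by (simp add: accept_test_def)

text \<open>Decrementing first makes a counter started at \<open>n + 1\<close> visit the counts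
  \<open>n\<close> down to \<open>0\<close>. Rejection leaves the cleared cell alone;
  \<open>''e''\<close> accumulates the expectation.\<close>

definition decide :: com where
  "decide = Seq (decrement ''g'')
     (If accept_test
       (Seq (NStore ''table'' current_index (NConst 1))
         (RAssign ''e'' (RAdd (RVar ''e'') (RMul (RArr ''B'' (NVar ''g'')) accept_value))))
       (RAssign ''e'' (RAdd (RVar ''e'') (RMul (RArr ''B'' (NVar ''g'')) reject_value))))"

definition state_prog :: com where
  "state_prog = Seq
     (Seq (RAssign ''e'' (ROf (NConst 0))) (NAssign ''g'' (NAdd (NVar ''n'') (NConst 1))))
     (Seq (While (positive ''g'') decide)
       (Seq (RStore ''V'' (NVar ''j'') (RVar ''e'')) (decrement ''j'')))"

text \<open>
  One array of values suffices: with \<open>j\<close> candidates still to be selected, the new value needs only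
  the old values at \<open>j\<close> and \<open>j - 1\<close>.
\<close>
definition candidate_prog :: com where
  "candidate_prog = Seq (NAssign ''j'' (NVar ''k''))
     (Seq (While (positive ''j'') state_prog) (decrement ''a''))"

definition dp_prog :: com where
  "dp_prog = Seq (NAssign ''a'' (NVar ''m'')) (While (positive ''a'') candidate_prog)"

definition election_prog :: com where
  "election_prog = Seq weights_prog (Seq clear_prog dp_prog)"

subsection \<open>Binomial weights\<close>

context
  fixes n m k :: nat and p :: real
begin

lemma runs_weights_clear:
  "runs (\<lambda>s. input_store n m k p s \<and> nvar s ''g'' = n)
     (While (positive ''g'') weights_clear) ((n + 1) * 4 + n * 8)
     (\<lambda>s. input_store n m k p s \<and> (\<forall>g. 0 < g \<and> g \<le> n \<longrightarrow> rarr s ''B'' g = 0))"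
proof (rule runs_countdown[where I = "\<lambda>q s. input_store n m k p s \<and> nvar s ''g'' = q \<and>
      (\<forall>g. q < g \<and> g \<le> n \<longrightarrow> rarr s ''B'' g = 0)"])
qed (auto intro!: runs_wp intro: Suc_lessI simp: weights_clear_def input_store_def)

definition weights_inv :: "nat \<Rightarrow> store \<Rightarrow> bool" where
  "weights_inv q s \<longleftrightarrow> input_store n m k p s \<and> nvar s ''i'' = q \<and> q \<le> n \<and>
     (\<forall>g\<le>n. rarr s ''B'' g = binomial_weight p (n - q) g)"

text \<open>Cells above \<open>q\<close> hold the new row, the others the old one. Updating cell
  \<open>q\<close> reads only \<open>q\<close> and \<open>q - 1\<close>, both still old.\<close>

definition weights_row_inv :: "nat \<Rightarrow> nat \<Rightarrow> store \<Rightarrow> bool" where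
  "weights_row_inv i q s \<longleftrightarrow> input_store n m k p s \<and> nvar s ''i'' = Suc i \<and> i < n \<and>
     nvar s ''g'' = q \<and> q \<le> n \<and>
     (\<forall>g\<le>n. rarr s ''B'' g = binomial_weight p (if q < g then n - i else n - Suc i) g)"

lemma runs_weights_update: "runs (weights_row_inv i (Suc q)) weights_update 24 (weights_row_inv i q)"
proof (rule runs_wp)
  fix s
  assume s: "weights_row_inv i (Suc q) s"
  then have "n - i = Suc (n - Suc i)"
    by (simp add: weights_row_inv_def Suc_diff_Suc)
  with s show "wp weights_update (weights_row_inv i q) s"
    by (auto simp: weights_update_def weights_row_inv_def input_store_def dest: Suc_lessI)
qed (simp add: weights_update_def)

lemma runs_weights_row:
  "runs (weights_inv (Suc i)) weights_row (2 + ((n + 1) * 4 + n * 24 + 14)) (weights_inv i)"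
  unfolding weights_row_def
proof (intro runs_Seq)
  show "runs (weights_inv (Suc i)) (NAssign ''g'' (NVar ''n'')) 2 (weights_row_inv i n)"
    by (rule runs_wp) (auto simp: weights_inv_def weights_row_inv_def input_store_def)
  show "runs (weights_row_inv i n) (While (positive ''g'') weights_update)
      ((n + 1) * 4 + n * 24) (weights_row_inv i 0)"
    by (rule runs_countdown[where I = "weights_row_inv i", OF _ _ runs_weights_update])
      (auto simp: weights_row_inv_def)
  show "runs (weights_row_inv i 0) (Seq (RStore ''B'' (NConst 0)
      (RMul (RSub (ROf (NConst 1)) (RVar ''p'')) (RArr ''B'' (NConst 0)))) (decrement ''i''))
      14 (weights_inv i)"
  proof (rule runs_wp)
    fix s
    assume s: "weights_row_inv i 0 s"
    then have "n - i = Suc (n - Suc i)"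
      by (simp add: weights_row_inv_def Suc_diff_Suc)
    with s show "wp (Seq (RStore ''B'' (NConst 0)
        (RMul (RSub (ROf (NConst 1)) (RVar ''p'')) (RArr ''B'' (NConst 0)))) (decrement ''i''))
        (weights_inv i) s"
      by (auto simp: weights_row_inv_def weights_inv_def input_store_def)
  qed simp
qed

definition weights_ready :: "store \<Rightarrow> bool" where
  "weights_ready s \<longleftrightarrow> input_store n m k p s \<and> (\<forall>g\<le>n. rarr s ''B'' g = binomial_weight p n g)"

text \<open>Time bounds keep the nested shape produced by \<open>runs_Seq\<close> and
  \<open>runs_countdown\<close>; they are simplified only once, for the whole program.\<close>

lemma runs_weights_prog:
  "runs (input_store n m k p) weights_prog
     (2 + ((n + 1) * 4 + n * 8 +
       (6 + ((n + 1) * 4 + n * (2 + ((n + 1) * 4 + n * 24 + 14)))))) weights_ready"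
  unfolding weights_prog_def
proof (intro runs_Seq)
  show "runs (input_store n m k p) (NAssign ''g'' (NVar ''n'')) 2
      (\<lambda>s. input_store n m k p s \<and> nvar s ''g'' = n)"
    by (rule runs_wp) (auto simp: input_store_def)
  show "runs (\<lambda>s. input_store n m k p s \<and> (\<forall>g. 0 < g \<and> g \<le> n \<longrightarrow> rarr s ''B'' g = 0))
      (Seq (RStore ''B'' (NConst 0) (ROf (NConst 1))) (NAssign ''i'' (NVar ''n''))) 6
      (weights_inv n)"
    by (rule runs_wp) (auto simp: input_store_def weights_inv_def)
  show "runs (weights_inv n) (While (positive ''i'') weights_row)
      ((n + 1) * 4 + n * (2 + ((n + 1) * 4 + n * 24 + 14))) weights_ready"
    by (rule runs_countdown[where I = "weights_inv", OF _ _ runs_weights_row])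
      (auto simp: weights_inv_def weights_ready_def)
qed (rule runs_weights_clear)

subsection \<open>Clearing the table and the values\<close>

definition table_size :: nat where
  "table_size = (m + 1) * (k + 1) * (n + 1)"

definition table_zero :: "store \<Rightarrow> bool" where
  "table_zero s \<longleftrightarrow> weights_ready s \<and> (\<forall>i<table_size. narr s ''table'' i = 0)"

lemma runs_table_clear:
  "runs (\<lambda>s. weights_ready s \<and> nvar s ''z'' = table_size) (While (positive ''z'') table_clear)
     ((table_size + 1) * 4 + table_size * 7) table_zero"
proof (rule runs_countdown[where I = "\<lambda>q s. weights_ready s \<and> nvar s ''z'' = q \<and>
      (\<forall>i<table_size. q \<le> i \<longrightarrow> narr s ''table'' i = 0)"])
  fix q
  show "runs (\<lambda>s. weights_ready s \<and> nvar s ''z'' = Suc q \<and>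
        (\<forall>i<table_size. Suc q \<le> i \<longrightarrow> narr s ''table'' i = 0)) table_clear 7
      (\<lambda>s. weights_ready s \<and> nvar s ''z'' = q \<and>
        (\<forall>i<table_size. q \<le> i \<longrightarrow> narr s ''table'' i = 0))"
    by (rule runs_wp)
      (auto simp: table_clear_def weights_ready_def input_store_def Suc_le_eq nat_less_le)
qed (simp_all add: table_zero_def)

definition initialized :: "store \<Rightarrow> bool" where
  "initialized s \<longleftrightarrow> table_zero s \<and> (\<forall>j\<le>k. rarr s ''V'' j = 0)"

lemma runs_values_clear:
  "runs (\<lambda>s. table_zero s \<and> nvar s ''j'' = k \<and> rarr s ''V'' 0 = 0)
     (While (positive ''j'') values_clear) ((k + 1) * 4 + k * 8) initialized"
proof (rule runs_countdown[where I = "\<lambda>q s. table_zero s \<and> nvar s ''j'' = q \<and>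
      rarr s ''V'' 0 = 0 \<and> (\<forall>j. q < j \<and> j \<le> k \<longrightarrow> rarr s ''V'' j = 0)"])
  show "initialized s" if "table_zero s \<and> nvar s ''j'' = 0 \<and>
      rarr s ''V'' 0 = 0 \<and> (\<forall>j. 0 < j \<and> j \<le> k \<longrightarrow> rarr s ''V'' j = 0)" for s
    using that unfolding initialized_def by (metis gr0I)
qed (auto intro!: runs_wp intro: Suc_lessI simp: values_clear_def weights_ready_def
    table_zero_def input_store_def)

lemma runs_clear_prog:
  "runs weights_ready clear_prog
     (12 + ((table_size + 1) * 4 + table_size * 7 + (6 + ((k + 1) * 4 + k * 8)))) initialized"
  unfolding clear_prog_def
proof (intro runs_Seq)
  show "runs weights_ready (NAssign ''z''
      (NMul (NMul (NAdd (NVar ''m'') (NConst 1)) (NAdd (NVar ''k'') (NConst 1)))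
        (NAdd (NVar ''n'') (NConst 1)))) 12
      (\<lambda>s. weights_ready s \<and> nvar s ''z'' = table_size)"
    by (rule runs_wp) (auto simp: input_store_def weights_ready_def table_size_def)
  show "runs table_zero (Seq (RStore ''V'' (NConst 0) (ROf (NConst 0))) (NAssign ''j'' (NVar ''k'')))
      6 (\<lambda>s. table_zero s \<and> nvar s ''j'' = k \<and> rarr s ''V'' 0 = 0)"
    by (rule runs_wp) (auto simp: input_store_def weights_ready_def table_zero_def)
qed (rule runs_table_clear runs_values_clear)+

subsection \<open>The dynamic program\<close>

text \<open>\<open>D\<close> marks the states already decided; all other cells must still be zero.
  Indexing by \<open>j = k - \<beta>\<close> follows the loops, and \<open>0 < j\<close> keeps the
  row of a full committee at no.\<close>

definition table_correct :: "(nat \<Rightarrow> nat \<Rightarrow> nat \<Rightarrow> bool) \<Rightarrow> (nat \<Rightarrow> nat) \<Rightarrow> bool" where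
  "table_correct D tab \<longleftrightarrow> (\<forall>\<alpha>\<le>m. \<forall>j\<le>k. \<forall>\<gamma>\<le>n. tab (table_index n k \<alpha> (k - j) \<gamma>) =
     (if D \<alpha> j \<gamma> \<and> 0 < j \<and> accepts n p (m - \<alpha>) j \<gamma> then 1 else 0))"

text \<open>A mixed-radix representation: division by \<open>n + 1\<close> and then by
  \<open>k + 1\<close> recovers the digits.\<close>

lemma table_index_inj:
  assumes "table_index n k \<alpha> \<beta> \<gamma> = table_index n k \<alpha>' \<beta>' \<gamma>'"
    and "\<beta> \<le> k" "\<beta>' \<le> k" "\<gamma> \<le> n" "\<gamma>' \<le> n"
  shows "\<alpha> = \<alpha>' \<and> \<beta> = \<beta>' \<and> \<gamma> = \<gamma>'"
proof -
  have quotient: "(a * (c + 1) + b) div (c + 1) = a" if "b \<le> c" for a b c :: nat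
    by (rule div_nat_eqI) (use that in auto)
  have 1: "a = a' \<and> b = b'" if "a * (c + 1) + b = a' * (c + 1) + b'" "b \<le> c" "b' \<le> c"
    for a b a' b' c :: nat
    using quotient[OF that(2), of a] quotient[OF that(3), of a'] that(1) by simp
  have "\<alpha> * (k + 1) + \<beta> = \<alpha>' * (k + 1) + \<beta>' \<and> \<gamma> = \<gamma>'"
    using assms(1) unfolding table_index_def by (rule 1) (fact assms)+
  then show ?thesis
    using 1[of \<alpha> k \<beta> \<alpha>' \<beta>'] assms(2,3) by blast
qed

lemma table_index_less:
  assumes "\<alpha> \<le> m" "\<beta> \<le> k" "\<gamma> \<le> n"
  shows "table_index n k \<alpha> \<beta> \<gamma> < table_size"
proof -
  have "\<alpha> * (k + 1) + \<beta> < (m + 1) * (k + 1)"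
    using assms(1,2) mult_le_mono1[of \<alpha> m "k + 1"] by (simp add: algebra_simps)
  then have "(\<alpha> * (k + 1) + \<beta> + 1) * (n + 1) \<le> (m + 1) * (k + 1) * (n + 1)"
    by (intro mult_le_mono1) simp
  then show ?thesis
    using assms(3) by (simp add: table_index_def table_size_def algebra_simps)
qed

text \<open>Deciding one more state: acceptance writes a one, rejection may write nothing because an
  undecided cell is zero. Injectivity of the layout protects the other cells.\<close>

lemma table_correct_step:
  assumes "table_correct D tab" and "\<alpha> \<le> m" "0 < j" "j \<le> k" "\<gamma> \<le> n" and "\<not> D \<alpha> j \<gamma>"
    and "\<And>a b c. D' a b c \<longleftrightarrow> D a b c \<or> a = \<alpha> \<and> b = j \<and> c = \<gamma>"
  shows "accepts n p (m - \<alpha>) j \<gamma> \<Longrightarrow> table_correct D' (tab(table_index n k \<alpha> (k - j) \<gamma> := 1))"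
    and "\<not> accepts n p (m - \<alpha>) j \<gamma> \<Longrightarrow> table_correct D' tab"
proof -
  let ?i = "\<lambda>\<alpha> j \<gamma>. table_index n k \<alpha> (k - j) \<gamma>"
  have old: "tab (?i a b c) = (if D a b c \<and> 0 < b \<and> accepts n p (m - a) b c then 1 else 0)"
    if "a \<le> m" "b \<le> k" "c \<le> n" for a b c
    using assms(1) that by (simp add: table_correct_def)
  have inj: "a = \<alpha> \<and> b = j \<and> c = \<gamma>"
    if "?i a b c = ?i \<alpha> j \<gamma>" "b \<le> k" "c \<le> n" for a b c
    using table_index_inj[OF that(1)] that(2,3) assms(4,5) by (simp add: diff_le_self) linarith
  show "table_correct D' (tab(?i \<alpha> j \<gamma> := 1))" if "accepts n p (m - \<alpha>) j \<gamma>"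
    unfolding table_correct_def
  proof (intro allI impI)
    fix a b c
    assume le: "a \<le> m" "b \<le> k" "c \<le> n"
    show "(tab(?i \<alpha> j \<gamma> := 1)) (?i a b c) =
        (if D' a b c \<and> 0 < b \<and> accepts n p (m - a) b c then 1 else 0)"
    proof (cases "a = \<alpha> \<and> b = j \<and> c = \<gamma>")
      case True
      with that assms(3,7) show ?thesis by simp
    next
      case False
      then have "?i a b c \<noteq> ?i \<alpha> j \<gamma>" and "D' a b c = D a b c"
        using inj le assms(7) by blast+
      then show ?thesis
        using old[OF le] by simp
    qed
  qed
  show "table_correct D' tab" if "\<not> accepts n p (m - \<alpha>) j \<gamma>"
    unfolding table_correct_def
  proof (intro allI impI)
    fix a b c
    assume le: "a \<le> m" "b \<le> k" "c \<le> n"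
    show "tab (?i a b c) = (if D' a b c \<and> 0 < b \<and> accepts n p (m - a) b c then 1 else 0)"
      using old[OF le] that assms(7)[of a b c] by auto
  qed
qed

definition dp_inv :: "nat \<Rightarrow> store \<Rightarrow> bool" where
  "dp_inv a s \<longleftrightarrow> weights_ready s \<and> nvar s ''a'' = a \<and> a \<le> m \<and>
     (\<forall>j\<le>k. rarr s ''V'' j = opt_value n p (m - a) j) \<and>
     table_correct (\<lambda>\<alpha> j \<gamma>. a < \<alpha>) (narr s ''table'')"

text \<open>\<open>''V''\<close> mixes two stages: entries above \<open>q\<close> count candidate
  \<open>Suc a\<close> among those still to come, the others do not.\<close>

definition candidate_inv :: "nat \<Rightarrow> nat \<Rightarrow> store \<Rightarrow> bool" where
  "candidate_inv a q s \<longleftrightarrow> weights_ready s \<and> nvar s ''a'' = Suc a \<and> a < m \<and>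
     nvar s ''j'' = q \<and> q \<le> k \<and>
     (\<forall>j\<le>k. rarr s ''V'' j = opt_value n p (if q < j then m - a else m - Suc a) j) \<and>
     table_correct (\<lambda>\<alpha> j \<gamma>. Suc a < \<alpha> \<or> \<alpha> = Suc a \<and> q < j) (narr s ''table'')"

definition choice_value :: "nat \<Rightarrow> nat \<Rightarrow> nat \<Rightarrow> real" where
  "choice_value r j g = (if accepts n p r (Suc j) g
     then real g + opt_value n p r j else opt_value n p r (Suc j))"

definition state_inv :: "nat \<Rightarrow> nat \<Rightarrow> nat \<Rightarrow> store \<Rightarrow> bool" where
  "state_inv a q x s \<longleftrightarrow> weights_ready s \<and> nvar s ''a'' = Suc a \<and> a < m \<and>
     nvar s ''j'' = Suc q \<and> q < k \<and> nvar s ''g'' = x \<and> x \<le> Suc n \<and>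
     rvar s ''e'' = (\<Sum>g = x..n. binomial_weight p n g * choice_value (m - Suc a) q g) \<and>
     (\<forall>j\<le>k. rarr s ''V'' j = opt_value n p (if Suc q < j then m - a else m - Suc a) j) \<and>
     table_correct (\<lambda>\<alpha> j \<gamma>. Suc a < \<alpha> \<or> \<alpha> = Suc a \<and> (Suc q < j \<or> j = Suc q \<and> x \<le> \<gamma>))
       (narr s ''table'')"

lemma opt_value_Suc_Suc:
  "opt_value n p (Suc r) (Suc j) = (\<Sum>g=0..n. binomial_weight p n g * choice_value r j g)"
  by (simp add: choice_value_def accepts_def atMost_atLeast0)

lemma runs_decide: "runs (state_inv a q (Suc x)) decide 60 (state_inv a q x)"
proof (rule runs_wp)
  fix s
  assume s: "state_inv a q (Suc x) s"
  let ?D = "\<lambda>\<alpha> j \<gamma>. Suc a < \<alpha> \<or> \<alpha> = Suc a \<and> (Suc q < j \<or> j = Suc q \<and> Suc x \<le> \<gamma>)"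
  let ?D' = "\<lambda>\<alpha> j \<gamma>. Suc a < \<alpha> \<or> \<alpha> = Suc a \<and> (Suc q < j \<or> j = Suc q \<and> x \<le> \<gamma>)"
  have D: "?D' \<alpha> j \<gamma> \<longleftrightarrow> ?D \<alpha> j \<gamma> \<or> \<alpha> = Suc a \<and> j = Suc q \<and> \<gamma> = x" for \<alpha> j \<gamma>
    by auto
  have x: "x \<le> n" and a: "a < m" and q: "q < k"
    using s by (auto simp: state_inv_def)
  have tab: "table_correct ?D (narr s ''table'')"
    using s by (simp add: state_inv_def)
  note table = table_correct_step[OF tab _ _ _ x _ D]
  have sum: "(\<Sum>g = x..n. binomial_weight p n g * choice_value (m - Suc a) q g) =
      binomial_weight p n x * choice_value (m - Suc a) q x +
      (\<Sum>g = Suc x..n. binomial_weight p n g * choice_value (m - Suc a) q g)"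
    using x by (simp add: sum.atLeast_Suc_atMost)
  \<comment> \<open>\<open>a < m\<close> makes the additive test of the program agree with the
    subtraction in \<open>accepts\<close>.\<close>
  have accepts: "accepts n p (m - Suc a) (Suc q) x \<longleftrightarrow> m < Suc a + Suc q \<or>
      opt_value n p (m - Suc a) (Suc q) \<le> real x + opt_value n p (m - Suc a) q"
    using a by (auto simp: accepts_def)
  show "wp decide (state_inv a q x) s"
  proof (cases "accepts n p (m - Suc a) (Suc q) x")
    case True
    then have "table_correct ?D'
        ((narr s ''table'')(table_index n k (Suc a) (k - Suc q) x := 1))"
      using table(1) a q by simp
    moreover have "choice_value (m - Suc a) q x = real x + opt_value n p (m - Suc a) q"
      using True by (simp add: choice_value_def)
    ultimately show ?thesis
      using s True[unfolded accepts] x a q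
      by (simp add: decide_def state_inv_def weights_ready_def input_store_def sum)
  next
    case False
    then have "table_correct ?D' (narr s ''table'')"
      using table(2) a q by simp
    moreover have "choice_value (m - Suc a) q x = opt_value n p (m - Suc a) (Suc q)"
      using False by (simp add: choice_value_def)
    ultimately show ?thesis
      using s False[unfolded accepts] x a q
      by (simp add: decide_def state_inv_def weights_ready_def input_store_def sum)
  qed
qed (simp add: decide_def)

lemma runs_state_prog:
  "runs (candidate_inv a (Suc q)) state_prog
     (7 + ((n + 1 + 1) * 4 + (n + 1) * 60 + 7)) (candidate_inv a q)"
  unfolding state_prog_def
proof (intro runs_Seq)
  \<comment> \<open>At \<open>x = n + 1\<close> the sum is empty and no
    \<open>\<gamma> \<le> n\<close> satisfies \<open>x \<le> \<gamma>\<close>, so both invariants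
    describe the same cells.\<close>
  show "runs (candidate_inv a (Suc q))
      (Seq (RAssign ''e'' (ROf (NConst 0))) (NAssign ''g'' (NAdd (NVar ''n'') (NConst 1))))
      7 (state_inv a q (n + 1))"
    by (rule runs_wp) (auto simp: candidate_inv_def state_inv_def weights_ready_def
        input_store_def table_correct_def)
  show "runs (state_inv a q (n + 1)) (While (positive ''g'') decide)
      ((n + 1 + 1) * 4 + (n + 1) * 60) (state_inv a q 0)"
    by (rule runs_countdown[where I = "state_inv a q", OF _ _ runs_decide])
      (auto simp: state_inv_def)
  show "runs (state_inv a q 0) (Seq (RStore ''V'' (NVar ''j'') (RVar ''e'')) (decrement ''j''))
      7 (candidate_inv a q)"
  proof (rule runs_wp)
    fix s
    assume s: "state_inv a q 0 s"
    then have "m - a = Suc (m - Suc a)"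
      by (simp add: state_inv_def Suc_diff_Suc)
    \<comment> \<open>At \<open>x = 0\<close> the condition on \<open>\<gamma>\<close> is void, so
      all counts for \<open>Suc q\<close> are decided.\<close>
    moreover have "(Suc q < j \<or> j = Suc q) = (q < j)" for j
      by auto
    ultimately show "wp (Seq (RStore ''V'' (NVar ''j'') (RVar ''e'')) (decrement ''j''))
        (candidate_inv a q) s"
      using s by (auto simp: state_inv_def candidate_inv_def weights_ready_def input_store_def
          opt_value_Suc_Suc simp del: opt_value.simps)
  qed simp
qed

lemma runs_candidate_prog:
  "runs (dp_inv (Suc a)) candidate_prog
     (2 + ((k + 1) * 4 + k * (7 + ((n + 1 + 1) * 4 + (n + 1) * 60 + 7)) + 4)) (dp_inv a)"
  unfolding candidate_prog_def
proof (intro runs_Seq)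
  show "runs (dp_inv (Suc a)) (NAssign ''j'' (NVar ''k'')) 2 (candidate_inv a k)"
    by (rule runs_wp) (auto simp: dp_inv_def candidate_inv_def weights_ready_def
        input_store_def table_correct_def)
  show "runs (candidate_inv a k) (While (positive ''j'') state_prog)
      ((k + 1) * 4 + k * (7 + ((n + 1 + 1) * 4 + (n + 1) * 60 + 7))) (candidate_inv a 0)"
    by (rule runs_countdown[where I = "candidate_inv a", OF _ _ runs_state_prog])
      (auto simp: candidate_inv_def)
  show "runs (candidate_inv a 0) (decrement ''a'') 4 (dp_inv a)"
  proof (rule runs_wp)
    fix s
    assume s: "candidate_inv a 0 s"
    \<comment> \<open>Entry \<open>0\<close> is never overwritten, but with nothing to select the
      value is \<open>0\<close> at both stages.\<close>
    then have "rarr s ''V'' j = opt_value n p (m - a) j" if "j \<le> k" for j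
      using that by (cases j) (auto simp: candidate_inv_def)
    moreover have "table_correct (\<lambda>\<alpha> j \<gamma>. a < \<alpha>) (narr s ''table'')"
      using s unfolding candidate_inv_def table_correct_def
      by (auto simp: Suc_lessI less_Suc_eq)
    ultimately show "wp (decrement ''a'') (dp_inv a) s"
      using s by (simp add: candidate_inv_def dp_inv_def weights_ready_def input_store_def)
  qed simp
qed

lemma runs_dp_prog:
  "runs initialized dp_prog
     (2 + ((m + 1) * 4 +
       m * (2 + ((k + 1) * 4 + k * (7 + ((n + 1 + 1) * 4 + (n + 1) * 60 + 7)) + 4)))) (dp_inv 0)"
  unfolding dp_prog_def
proof (intro runs_Seq)
  \<comment> \<open>No \<open>\<alpha> \<le> m\<close> exceeds \<open>m\<close>, so initially
    correctness asks for zeros only; \<open>table_index_less\<close> places them in the cleared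
    range.\<close>
  show "runs initialized (NAssign ''a'' (NVar ''m'')) 2 (dp_inv m)"
    by (rule runs_wp) (auto simp: initialized_def dp_inv_def table_zero_def weights_ready_def
        input_store_def table_correct_def table_index_less)
  show "runs (dp_inv m) (While (positive ''a'') candidate_prog)
      ((m + 1) * 4 +
       m * (2 + ((k + 1) * 4 + k * (7 + ((n + 1 + 1) * 4 + (n + 1) * 60 + 7)) + 4))) (dp_inv 0)"
    by (rule runs_countdown[where I = "dp_inv", OF _ _ runs_candidate_prog])
      (auto simp: dp_inv_def)
qed

section \<open>Reading off the table and adding up the running time\<close>

lemma dp_inv_output: "dp_inv 0 s \<Longrightarrow> output_table n m k (opt_table n m k p) s"
  unfolding output_table_def
proof (intro ballI)
  fix \<alpha> \<beta> \<gamma>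
  assume s: "dp_inv 0 s" and \<alpha>: "\<alpha> \<in> {1..m}" and \<beta>: "\<beta> \<in> {0..min k (\<alpha> - 1)}" and \<gamma>: "\<gamma> \<in> {0..n}"
  \<comment> \<open>\<open>table_correct\<close> is used at \<open>j = k - \<beta>\<close>; since
    \<open>\<beta> \<le> k\<close>, the column \<open>k - (k - \<beta>)\<close> is
    \<open>\<beta>\<close> again.\<close>
  have "narr s ''table'' (table_index n k \<alpha> (k - (k - \<beta>)) \<gamma>) =
      (if 0 < k - \<beta> \<and> accepts n p (m - \<alpha>) (k - \<beta>) \<gamma> then 1 else 0)"
    using s \<alpha> \<gamma> unfolding dp_inv_def table_correct_def by simp
  then show "narr s ''table'' (table_index n k \<alpha> \<beta> \<gamma>) =
      (case opt_table n m k p \<alpha> \<beta> \<gamma> of Yes \<Rightarrow> 1 | No \<Rightarrow> 0)"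
    using \<beta> by (simp add: opt_table_def)
qed

text \<open>The weights give the \<open>n * n\<close> term, clearing and the dynamic program the
  \<open>n * k * m\<close> term. Maxima with \<open>1\<close> let the single product absorb all
  lower terms, including constants; \<open>2000\<close> is generous.\<close>

lemma runs_election_prog:
  "runs (input_store n m k p) election_prog (2000 * ((max 1 n)\<^sup>2 * max 1 k * max 1 m)) (dp_inv 0)"
proof -
  define X Y Z where "X = max 1 n" and "Y = max 1 k" and "Z = max 1 m"
  define U where "U = X\<^sup>2 * Y * Z"
  have pos: "1 \<le> X" "1 \<le> Y" "1 \<le> Z" and le: "n \<le> X" "k \<le> Y" "m \<le> Z"
    by (auto simp: X_def Y_def Z_def)
  have prod: "a * b * c * d \<le> U" if "a \<le> X" "b \<le> X" "c \<le> Y" "d \<le> Z" for a b c d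
    unfolding U_def power2_eq_square using that by (intro mult_le_mono)
  \<comment> \<open>These are the monomials of the expanded bound; in \<open>prod\<close>, a missing
    factor is replaced by \<open>1\<close>.\<close>
  have bounds: "n * n \<le> U" "n \<le> U" "k \<le> U" "m \<le> U" "1 \<le> U" "n * k * m \<le> U" "n * m \<le> U"
      "k * m \<le> U" "n * k \<le> U"
    using prod[of n n 1 1] prod[of n 1 1 1] prod[of 1 1 k 1] prod[of 1 1 1 m] prod[of 1 1 1 1]
      prod[of n 1 k m] prod[of n 1 1 m] prod[of 1 1 k m] prod[of n 1 k 1] pos le by simp_all
  have "runs (input_store n m k p) election_prog
     (2 + ((n + 1) * 4 + n * 8 +
       (6 + ((n + 1) * 4 + n * (2 + ((n + 1) * 4 + n * 24 + 14))))) +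
      ((12 + ((table_size + 1) * 4 + table_size * 7 + (6 + ((k + 1) * 4 + k * 8)))) +
       (2 + ((m + 1) * 4 +
         m * (2 + ((k + 1) * 4 + k * (7 + ((n + 1 + 1) * 4 + (n + 1) * 60 + 7)) + 4))))))
     (dp_inv 0)"
    unfolding election_prog_def
    by (rule runs_Seq[OF runs_weights_prog runs_Seq[OF runs_clear_prog runs_dp_prog]])
  then show ?thesis
    unfolding X_def[symmetric] Y_def[symmetric] Z_def[symmetric] U_def[symmetric]
  proof (rule runs_mono)
    show "2 + ((n + 1) * 4 + n * 8 +
       (6 + ((n + 1) * 4 + n * (2 + ((n + 1) * 4 + n * 24 + 14))))) +
      ((12 + ((table_size + 1) * 4 + table_size * 7 + (6 + ((k + 1) * 4 + k * 8)))) +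
       (2 + ((m + 1) * 4 +
         m * (2 + ((k + 1) * 4 + k * (7 + ((n + 1 + 1) * 4 + (n + 1) * 60 + 7)) + 4)))))
      \<le> 2000 * U"
      using bounds by (simp add: table_size_def algebra_simps)
  qed
qed

end

theorem proposition4p1:
  "\<exists>(prog :: com) (C :: nat). \<forall>(n :: nat) (m :: nat) (k :: nat) (p :: real) (s :: store).
     k \<le> m \<longrightarrow> 0 \<le> p \<longrightarrow> p \<le> 1 \<longrightarrow> input_store n m k p s \<longrightarrow>
     (\<exists>(time :: nat) (s' :: store) (T :: policy_table).
        exec prog s time s' \<and>
        time \<le> C * ((max 1 n)^2 * max 1 k * max 1 m) \<and>
        output_table n m k T s' \<and>
        optimal_safe n m k p (table_policy T))"
proof (rule exI[of _ election_prog], rule exI[of _ 2000], intro allI impI)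
  fix n m k :: nat and p :: real and s :: store
  assume "k \<le> m" "0 \<le> p" "p \<le> 1" "input_store n m k p s"
  moreover from this obtain time s' where "exec election_prog s time s'"
      "time \<le> 2000 * ((max 1 n)^2 * max 1 k * max 1 m)" "dp_inv n m k p 0 s'"
    using runs_election_prog[of n m k p] unfolding runs_def by blast
  ultimately show "\<exists>(time :: nat) (s' :: store) (T :: policy_table).
      exec election_prog s time s' \<and>
      time \<le> 2000 * ((max 1 n)^2 * max 1 k * max 1 m) \<and>
      output_table n m k T s' \<and>
      optimal_safe n m k p (table_policy T)"
    using dp_inv_output opt_table_optimal by blast
qed

end
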